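(* For any $\delta \in (0, \tfrac12)$ and any $\ell \in \mathbb{N}$ with $\ell \not\equiv 2 \pmod 4$, there exist $m \in \mathbb{N}$ and nonnegative real coefficients $c_1, \dots, c_m$ such that the trigonometric polynomial $$T(x) = \sum_{k=1}^m c_k \cos\left(kx - \frac{\ell\pi}{4}\right)$$ satisfies $$A := -\max_{x \in I_\delta} T(x) > 0.$$
   Context: $\mathbb{N} = \{1,2,3,\dots\}$. For $\delta \in (0,1/2)$, $I_\delta := [2\pi\delta,\, 2\pi(1-\delta)] \subset \mathbb{R}$. *)

theory Defs
  imports Complex_Main
begin

definition I_delta :: "real \<Rightarrow> real set" where
  "I_delta \<delta> = {2 * pi * \<delta> .. 2 * pi * (1 - \<delta>)}"

definition trig_poly :: "nat \<Rightarrow> nat \<Rightarrow> (nat \<Rightarrow> real) \<Rightarrow> real \<Rightarrow> real" where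
  "trig_poly l m c x = (\<Sum>k = 1..m. c k * cos (real k * x - real l * pi / 4))"

end

theory Submission
  imports Defs "HOL-Computational_Algebra.Polynomial" "HOL-Library.Nonpos_Ints"
begin

text \<open>
  Up to the factor \<open>cis (- l * pi / 4)\<close>, \<open>trig_poly\<close> is the real part of a polynomial \<open>p\<close> with
  nonnegative coefficients and \<open>p(0) = 0\<close>, evaluated at \<open>z = cis x\<close>. Since \<open>cos (l * pi / 4)\<close> is
  at least \<open>1 / sqrt 2\<close> in modulus unless \<open>l\<close> is \<open>2\<close> modulo \<open>4\<close>, it suffices to have such \<open>p\<close>
  close to \<open>-1\<close>, respectively close to \<open>1\<close>, uniformly on the arc. The Fejer sum \<open>S\<close> has
  nonnegative coefficients, \<open>S(0) = 0\<close> and negative real part on the arc; hence \<open>1 + h S\<close> has modulus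
  below a constant \<open>q < 1\<close> there for small \<open>h > 0\<close>, and \<open>p = (1 + h S)^N - 1\<close> is
  close to \<open>-1\<close>. Its square is close to \<open>1\<close>.
\<close>

definition nonneg_coeffs :: "complex poly \<Rightarrow> bool" where
  "nonneg_coeffs p \<longleftrightarrow> (\<forall>k. coeff p k \<in> \<real>\<^sub>\<ge>\<^sub>0)"

lemma nonneg_Reals_sum_I:
  "(\<And>i. i \<in> A \<Longrightarrow> f i \<in> \<real>\<^sub>\<ge>\<^sub>0) \<Longrightarrow> sum f A \<in> \<real>\<^sub>\<ge>\<^sub>0"
  by (induction A rule: infinite_finite_induct) auto

lemma nonneg_coeffs_add: "nonneg_coeffs p \<Longrightarrow> nonneg_coeffs q \<Longrightarrow> nonneg_coeffs (p + q)"
  by (simp add: nonneg_coeffs_def)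

lemma nonneg_coeffs_mult: "nonneg_coeffs p \<Longrightarrow> nonneg_coeffs q \<Longrightarrow> nonneg_coeffs (p * q)"
  by (auto simp: nonneg_coeffs_def coeff_mult intro!: nonneg_Reals_sum_I)

lemma nonneg_coeffs_monom: "a \<in> \<real>\<^sub>\<ge>\<^sub>0 \<Longrightarrow> nonneg_coeffs (monom a k)"
  by (simp add: nonneg_coeffs_def coeff_monom)

lemma nonneg_coeffs_one: "nonneg_coeffs 1"
  using nonneg_coeffs_monom[of 1 0] by (simp add: monom_eq_1)

lemma nonneg_coeffs_power: "nonneg_coeffs p \<Longrightarrow> nonneg_coeffs (p ^ n)"
  by (induction n) (auto intro: nonneg_coeffs_mult nonneg_coeffs_one)

lemma nonneg_coeffs_sum: "(\<And>i. i \<in> A \<Longrightarrow> nonneg_coeffs (f i)) \<Longrightarrow> nonneg_coeffs (sum f A)"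
  by (auto simp: nonneg_coeffs_def coeff_sum intro!: nonneg_Reals_sum_I)

text \<open>With \<open>z\<close> on the unit circle, the numerator of the real part is
  \<open>Re z - 1\<close> and the denominator is \<open>2 - 2 * Re z\<close>.\<close>

lemma Re_div_one_minus:
  assumes "norm z = 1" "z \<noteq> 1"
  shows "Re (z / (1 - z)) = - 1 / 2"
proof -
  have sq: "(Re z)\<^sup>2 + (Im z)\<^sup>2 = 1"
    using assms(1) by (metis cmod_power2 one_power2)
  have ne: "(1 - Re z)\<^sup>2 + (Im z)\<^sup>2 \<noteq> 0"
    using assms(2) by (auto simp: complex_eq_iff sum_power2_eq_zero_iff)
  have "Re z * (1 - Re z) - (Im z)\<^sup>2 = - ((1 - Re z)\<^sup>2 + (Im z)\<^sup>2) / 2"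
    using sq by (simp add: power2_eq_square field_simps)
  then have "(Re z * (1 - Re z) - (Im z)\<^sup>2) / ((1 - Re z)\<^sup>2 + (Im z)\<^sup>2) = - 1 / 2"
    using ne by (simp add: field_simps)
  then show ?thesis
    by (simp add: Re_divide power2_eq_square)
qed

text \<open>The coefficient at \<open>1 <= k < n\<close> is \<open>n - k\<close>. On the unit
  circle, \<open>n + 2 * Re\<close> of the value is \<open>n\<close> times the Fejer kernel. The
  double sum keeps the inner sums geometric.\<close>

definition fejer_poly :: "nat \<Rightarrow> complex poly" where
  "fejer_poly n = (\<Sum>j<n. \<Sum>k=1..j. monom 1 k)"

lemma nonneg_coeffs_fejer_poly: "nonneg_coeffs (fejer_poly n)"
  unfolding fejer_poly_def by (intro nonneg_coeffs_sum nonneg_coeffs_monom) simp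

lemma coeff_0_fejer_poly: "coeff (fejer_poly n) 0 = 0"
  by (auto simp: fejer_poly_def coeff_sum intro!: sum.neutral)

lemma norm_fejer_poly_le:
  assumes "norm z = 1"
  shows "norm (poly (fejer_poly n) z) \<le> (real n)\<^sup>2"
proof -
  have "norm (\<Sum>k=1..j. z ^ k) \<le> real n" if "j < n" for j
  proof -
    have "norm (\<Sum>k=1..j. z ^ k) \<le> (\<Sum>k=1..j. norm (z ^ k))"
      by (rule norm_sum)
    also have "\<dots> = real j"
      using assms by (simp add: norm_power)
    finally show ?thesis
      using that by simp
  qed
  then have "norm (\<Sum>j<n. \<Sum>k=1..j. z ^ k) \<le> (\<Sum>j<n. real n)"
    by (intro sum_norm_le) auto
  then show ?thesis
    by (simp add: fejer_poly_def poly_sum poly_monom power2_eq_square)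
qed

text \<open>Summing the geometric series leaves \<open>n\<close> copies of
  \<open>z / (1 - z)\<close>, each of real part \<open>- 1 / 2\<close>, and a remainder bounded
  independently of \<open>n\<close>. So away from \<open>1\<close> the real part tends to minus
  infinity as \<open>n\<close> grows.\<close>

lemma Re_fejer_poly_le:
  assumes "norm z = 1" "z \<noteq> 1"
  shows "Re (poly (fejer_poly n) z) \<le> 2 / (norm (1 - z))\<^sup>2 - real n / 2"
proof -
  have ne: "1 - z \<noteq> 0"
    using assms by simp
  have "(1 - z) * (\<Sum>k=1..j. z ^ k) = z - z * z ^ j" for j
    by (induction j) (simp_all add: distrib_left, simp add: left_diff_distrib)
  then have "(\<Sum>k=1..j. z ^ k) = (z - z * z ^ j) / (1 - z)" for j
    using ne by (metis nonzero_mult_div_cancel_left)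
  then have inner: "(\<Sum>k=1..j. z ^ k) = z / (1 - z) - z / (1 - z) * z ^ j" for j
    by (simp add: diff_divide_distrib)
  have "(\<Sum>j<n. \<Sum>k=1..j. z ^ k) = of_nat n * (z / (1 - z)) - z / (1 - z) * (\<Sum>j<n. z ^ j)"
    by (simp only: inner sum_subtractf sum_distrib_left) simp
  also have "(\<Sum>j<n. z ^ j) = (1 - z ^ n) / (1 - z)"
    using assms sum_gp_strict[of z n] by simp
  finally have eq: "poly (fejer_poly n) z =
      of_nat n * (z / (1 - z)) - z * (1 - z ^ n) / (1 - z)\<^sup>2"
    by (simp add: fejer_poly_def poly_sum poly_monom power2_eq_square)
  have "norm (1 - z ^ n) \<le> norm (1::complex) + norm (z ^ n)"
    by (rule norm_triangle_ineq4)
  then have "norm (1 - z ^ n) \<le> 2"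
    using assms by (simp add: norm_power)
  then have "norm (z * (1 - z ^ n) / (1 - z)\<^sup>2) \<le> 2 / (norm (1 - z))\<^sup>2"
    using assms by (simp add: norm_mult norm_divide norm_power divide_right_mono)
  then have "- Re (z * (1 - z ^ n) / (1 - z)\<^sup>2) \<le> 2 / (norm (1 - z))\<^sup>2"
    using abs_Re_le_cmod[of "z * (1 - z ^ n) / (1 - z)\<^sup>2"] by linarith
  moreover have "Re (of_nat n * (z / (1 - z))) = real n * Re (z / (1 - z))"
    by (metis Re_complex_of_real of_real_of_nat_eq scaleR_complex.simps(1) scaleR_conv_of_real)
  ultimately show ?thesis
    unfolding eq minus_complex.simps using Re_div_one_minus[OF assms] by simp
qed

text \<open>In the expanded square the linear term gains \<open>2 * h\<close>, and the quadratic
  term gives back at most \<open>h\<close>.\<close>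

lemma cmod_one_add_scaled_le:
  assumes "Re w \<le> - 1" "norm w \<le> B" "0 < h" "h * B\<^sup>2 \<le> 1"
  shows "norm (1 + of_real h * w) \<le> sqrt (1 - h)"
proof -
  have "(norm (1 + of_real h * w))\<^sup>2 = 1 + 2 * h * Re w + h * (h * (norm w)\<^sup>2)"
    by (simp only: cmod_power2) (simp add: power2_eq_square algebra_simps)
  also have "\<dots> \<le> 1 + 2 * h * (- 1) + h * 1"
  proof -
    have "(norm w)\<^sup>2 \<le> B\<^sup>2"
      using assms(2) by (intro power_mono) auto
    then have "h * (norm w)\<^sup>2 \<le> 1"
      using assms(3,4) by (meson mult_left_mono less_imp_le order_trans)
    then show ?thesis
      using assms(1,3) by (intro add_mono mult_left_mono) auto
  qed
  finally have "(norm (1 + of_real h * w))\<^sup>2 \<le> 1 - h"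
    by simp
  then show ?thesis
    by (rule real_le_rsqrt)
qed

lemma nonneg_poly_near_minus_one:
  assumes "0 < c" "0 < e"
  obtains p where "nonneg_coeffs p" "coeff p 0 = 0"
    "\<And>z. norm z = 1 \<Longrightarrow> Re z \<le> 1 - c \<Longrightarrow> norm (poly p z + 1) \<le> e"
proof -
  \<comment> \<open>This makes the bound of \<open>Re_fejer_poly_le\<close> at most
    \<open>- 1\<close> wherever \<open>norm (1 - z)\<close> is at least \<open>c\<close>.\<close>
  obtain n where "real n > 2 * (1 + 2 / c\<^sup>2)"
    using reals_Archimedean2 by blast
  moreover have "2 / c\<^sup>2 > 0"
    using assms by simp
  ultimately have n: "2 / c\<^sup>2 - real n / 2 \<le> - 1" and "n > 0"
    by (simp_all, linarith+)
  \<comment> \<open>The largest \<open>h\<close> with \<open>h * B\<^sup>2 \<le> 1\<close> for the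
    norm bound \<open>B = n\<^sup>2\<close>.\<close>
  define h where "h = 1 / real n ^ 4"
  have h: "0 < h" "h * ((real n)\<^sup>2)\<^sup>2 \<le> 1" "h \<le> 1"
    using \<open>n > 0\<close> by (auto simp: h_def)
  define P where "P = 1 + monom (of_real h) 0 * fejer_poly n"
  have P: "nonneg_coeffs P"
    unfolding P_def using h
    by (intro nonneg_coeffs_add nonneg_coeffs_one nonneg_coeffs_mult nonneg_coeffs_monom
        nonneg_coeffs_fejer_poly) auto
  have P0: "coeff P 0 = 1"
    by (simp add: P_def coeff_mult_0 coeff_0_fejer_poly)
  have normP: "norm (poly P z) \<le> sqrt (1 - h)" if z: "norm z = 1" "Re z \<le> 1 - c" for z
  proof -
    have "z \<noteq> 1"
      using z assms by auto
    have "c \<le> norm (1 - z)"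
      using complex_Re_le_cmod[of "1 - z"] z by simp
    then have "2 / (norm (1 - z))\<^sup>2 \<le> 2 / c\<^sup>2"
      using assms \<open>z \<noteq> 1\<close> by (intro divide_left_mono power_mono) auto
    then have "Re (poly (fejer_poly n) z) \<le> - 1"
      using Re_fejer_poly_le[OF z(1) \<open>z \<noteq> 1\<close>, of n] n by linarith
    then show ?thesis
      using cmod_one_add_scaled_le[OF _ norm_fejer_poly_le[OF z(1)] h(1,2)]
      by (simp add: P_def poly_monom)
  qed
  have "sqrt (1 - h) < 1"
    using h by simp
  then obtain N where N: "sqrt (1 - h) ^ N < e"
    using real_arch_pow_inv[OF assms(2)] by blast
  show ?thesis
  proof
    \<comment> \<open>Subtracting \<open>1\<close> only cancels the constant coefficient of
      \<open>P ^ N\<close>, which is exactly \<open>1\<close>.\<close>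
    show "nonneg_coeffs (P ^ N - 1)"
      using nonneg_coeffs_power[OF P, of N] P0
      by (auto simp: nonneg_coeffs_def coeff_0_power)
    show "coeff (P ^ N - 1) 0 = 0"
      by (simp add: coeff_0_power P0)
    fix z :: complex assume "norm z = 1" "Re z \<le> 1 - c"
    then have "norm (poly P z) ^ N \<le> sqrt (1 - h) ^ N"
      by (intro power_mono normP) auto
    then show "norm (poly (P ^ N - 1) z + 1) \<le> e"
      using N by (simp add: poly_power norm_power)
  qed
qed

text \<open>The value \<open>3 / 5\<close> is a convenient rational below \<open>1 / sqrt 2\<close>.
  The accuracy \<open>1 / 5\<close> for \<open>p\<close> survives squaring, with error at most
  \<open>11 / 25\<close>.\<close>

lemma nonneg_poly_near_plus_minus_one:
  assumes "0 < c" and "s = 1 \<or> s = (- 1 :: complex)"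
  obtains p where "nonneg_coeffs p" "coeff p 0 = 0"
    "\<And>z. norm z = 1 \<Longrightarrow> Re z \<le> 1 - c \<Longrightarrow> norm (poly p z + s) \<le> 3 / 5"
proof -
  obtain p where p: "nonneg_coeffs p" "coeff p 0 = 0"
    and near: "\<And>z. norm z = 1 \<Longrightarrow> Re z \<le> 1 - c \<Longrightarrow> norm (poly p z + 1) \<le> 1 / 5"
    using nonneg_poly_near_minus_one[OF assms(1), of "1 / 5"] by auto
  consider "s = 1" | "s = - 1"
    using assms(2) by blast
  then show ?thesis
  proof cases
    case 1
    then show ?thesis
      using that[OF p] near by fastforce
  next
    case 2
    have "norm (poly (p * p) z + s) \<le> 3 / 5" if "norm z = 1" "Re z \<le> 1 - c" for z
    proof -
      have "poly p z - 1 = (poly p z + 1) - 2"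
        by simp
      then have "norm (poly p z - 1) \<le> norm (poly p z + 1) + 2"
        by (metis norm_triangle_ineq4 norm_numeral)
      moreover have "poly (p * p) z + s = (poly p z + 1) * (poly p z - 1)"
        using 2 by (simp add: algebra_simps)
      ultimately have "norm (poly (p * p) z + s) \<le> 1 / 5 * (1 / 5 + 2)"
        using near[OF that] by (simp only: norm_mult) (intro mult_mono, auto)
      then show ?thesis
        by simp
    qed
    then show ?thesis
      using that[of "p * p"] p by (simp add: nonneg_coeffs_mult coeff_mult_0)
  qed
qed

text \<open>The sum in \<open>trig_poly\<close> starts at \<open>k = 1\<close>, so the constant
  coefficient has to vanish. Real coefficients let \<open>Re\<close> pass to each
  exponential.\<close>

lemma trig_poly_eq_Re_poly:
  assumes "nonneg_coeffs p" "coeff p 0 = 0" "degree p \<le> m"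
  shows "trig_poly l m (\<lambda>k. Re (coeff p k)) x = Re (cis (- (real l * pi / 4)) * poly p (cis x))"
proof -
  have "poly p (cis x) = (\<Sum>k\<le>m. coeff p k * cis x ^ k)"
    unfolding poly_altdef using assms(3)
    by (intro sum.mono_neutral_left) (auto simp: coeff_eq_0)
  also have "\<dots> = (\<Sum>k=1..m. coeff p k * cis x ^ k)"
    using assms(2) by (intro sum.mono_neutral_right) (auto simp: Suc_le_eq)
  finally have "cis (- (real l * pi / 4)) * poly p (cis x) =
      (\<Sum>k=1..m. coeff p k * cis (real k * x - real l * pi / 4))"
    by (simp add: sum_distrib_left Complex.DeMoivre cis_mult mult.left_commute)
  moreover have "Im (coeff p k) = 0" for k
    using assms(1) by (simp add: nonneg_coeffs_def complex_nonneg_Reals_iff)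
  ultimately show ?thesis
    by (simp add: trig_poly_def)
qed

text \<open>The doubled angle \<open>l * pi / 2\<close> has a cosine depending only on
  \<open>l mod 4\<close>, with values 1, 0, -1, 0; excluding the residue 2 leaves it
  nonnegative.\<close>

lemma cos_quarter_pi_sq_ge:
  assumes "l mod 4 \<noteq> 2"
  shows "1 / 2 \<le> (cos (real l * pi / 4))\<^sup>2"
proof -
  have "real l = 4 * real (l div 4) + real (l mod 4)"
    by (metis of_nat_add of_nat_mult of_nat_numeral mult_div_mod_eq)
  then have "2 * (real l * pi / 4) = real (l mod 4) * pi / 2 + 2 * pi * of_int (int (l div 4))"
    by (simp add: field_simps)
  then have "cos (2 * (real l * pi / 4)) = cos (real (l mod 4) * pi / 2)"
    by (simp only: cos_add cos_int_2pin sin_int_2pin mult_1_right mult_zero_right diff_zero)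
  moreover have "l mod 4 = 0 \<or> l mod 4 = 1 \<or> l mod 4 = 3"
    using assms by presburger
  then have "cos (real (l mod 4) * pi / 2) \<ge> 0"
    using cos_3over2_pi by (elim disjE) (simp_all only: times_divide_eq_left, simp_all)
  ultimately show ?thesis
    using cos_double_cos[of "real l * pi / 4"] by simp
qed

lemma cos_le_on_I_delta:
  assumes "0 < \<delta>" "x \<in> I_delta \<delta>"
  shows "cos x \<le> cos (2 * pi * \<delta>)"
proof (cases "x \<le> pi")
  case True
  then show ?thesis
    using assms by (intro cos_monotone_0_pi_le) (auto simp: I_delta_def)
next
  case False
  \<comment> \<open>Reflection at \<open>pi\<close> maps the second half of the interval into the
    range where cosine decreases.\<close>
  then have "cos (2 * pi - x) \<le> cos (2 * pi * \<delta>)"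
    using assms by (intro cos_monotone_0_pi_le) (auto simp: I_delta_def algebra_simps)
  then show ?thesis
    by simp
qed

theorem lemma2p5:
  fixes \<delta> :: real and l :: nat
  assumes "0 < \<delta>" and "\<delta> < 1 / 2"
    and "1 \<le> l" and "l mod 4 \<noteq> 2"
  shows "\<exists>m \<ge> 1. \<exists>c :: nat \<Rightarrow> real. (\<forall>k\<in>{1..m}. 0 \<le> c k) \<and>
           (\<exists>x\<^sub>0. is_arg_max (trig_poly l m c) (\<lambda>x. x \<in> I_delta \<delta>) x\<^sub>0 \<and>
                 - trig_poly l m c x\<^sub>0 > 0)"
proof -
  define \<phi> where "\<phi> = real l * pi / 4"
  have "(3 / 5)\<^sup>2 < \<bar>cos \<phi>\<bar>\<^sup>2"
    using cos_quarter_pi_sq_ge[OF assms(4)] by (simp add: \<phi>_def power2_eq_square)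
  then have cos_gt: "3 / 5 < \<bar>cos \<phi>\<bar>"
    by (rule power2_less_imp_less) simp
  have "cos (2 * pi * \<delta>) < cos 0"
    using assms by (intro cos_monotone_0_pi) auto
  then have "0 < 1 - cos (2 * pi * \<delta>)"
    by simp
  \<comment> \<open>The polynomial is to be near \<open>- sgn (cos \<phi>)\<close>, so that the
    rotation by \<open>- \<phi>\<close> gives a real part near
    \<open>- \<bar>cos \<phi>\<bar>\<close>.\<close>
  moreover have "complex_of_real (sgn (cos \<phi>)) = 1 \<or> complex_of_real (sgn (cos \<phi>)) = - 1"
    using cos_gt by (auto simp: sgn_real_def)
  ultimately obtain p where p: "nonneg_coeffs p" "coeff p 0 = 0"
    and near: "\<And>z. norm z = 1 \<Longrightarrow> Re z \<le> 1 - (1 - cos (2 * pi * \<delta>))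
      \<Longrightarrow> norm (poly p z + of_real (sgn (cos \<phi>))) \<le> 3 / 5"
    using nonneg_poly_near_plus_minus_one by metis
  \<comment> \<open>The successor secures \<open>1 \<le> m\<close>; the extra coefficient is
    zero.\<close>
  define m where "m = Suc (degree p)"
  define c where "c = (\<lambda>k. Re (coeff p k))"
  have neg: "trig_poly l m c x < 0" if x: "x \<in> I_delta \<delta>" for x
  proof -
    define w where "w = poly p (cis x) + of_real (sgn (cos \<phi>))"
    have "norm w \<le> 3 / 5"
      unfolding w_def using cos_le_on_I_delta[OF assms(1) x] by (intro near) auto
    then have "Re (cis (- \<phi>) * w) \<le> 3 / 5"
      using complex_Re_le_cmod[of "cis (- \<phi>) * w"] by (simp add: norm_mult)
    moreover have "Re (cis (- \<phi>) * poly p (cis x)) = Re (cis (- \<phi>) * w) - \<bar>cos \<phi>\<bar>"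
      by (simp add: w_def algebra_simps abs_sgn)
    moreover have "trig_poly l m c x = Re (cis (- \<phi>) * poly p (cis x))"
      unfolding c_def \<phi>_def using p by (intro trig_poly_eq_Re_poly) (auto simp: m_def)
    ultimately show ?thesis
      using cos_gt by linarith
  qed
  have "2 * pi * \<delta> \<le> 2 * pi * (1 - \<delta>)"
    using assms by simp
  moreover have "continuous_on (I_delta \<delta>) (trig_poly l m c)"
    unfolding trig_poly_def by (intro continuous_intros)
  \<comment> \<open>By compactness the maximum is attained, so pointwise negativity already makes it
    negative.\<close>
  ultimately obtain x\<^sub>0 where "x\<^sub>0 \<in> I_delta \<delta>" "\<forall>y\<in>I_delta \<delta>. trig_poly l m c y \<le> trig_poly l m c x\<^sub>0"
    using continuous_attains_sup[of "I_delta \<delta>" "trig_poly l m c"] by (auto simp: I_delta_def)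
  then have "is_arg_max (trig_poly l m c) (\<lambda>x. x \<in> I_delta \<delta>) x\<^sub>0" "- trig_poly l m c x\<^sub>0 > 0"
    using neg by (auto simp: is_arg_max_def not_less)
  moreover have "\<forall>k\<in>{1..m}. 0 \<le> c k"
    using p(1) by (simp add: c_def nonneg_coeffs_def complex_nonneg_Reals_iff)
  moreover have "1 \<le> m"
    by (simp add: m_def)
  ultimately show ?thesis
    by blast
qed

end
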